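(* Let $$c^* := \inf_{w} \limsup_{N \to \infty} \frac{N\, D_N^*(w)}{\log N},$$ where the infimum is taken over all sequences $w = (x_1, x_2, \ldots)$ in $[0,1)$. Then $c^* \ge 0.0646363$. Equivalently, for every sequence $x_1, x_2, \ldots$ in $[0,1)$ one has $N D_N^* \ge 0.0646363 \cdot \log N$ for infinitely many $N$.
   Context: For a sequence $w = (x_1, x_2, \ldots)$ in $[0,1)$ and $N \ge 1$, the star discrepancy of its first $N$ elements is $$D_N^*(w) = \sup_{x \in [0,1]} \left| \frac{\mathcal{A}_N(x)}{N} - x \right|, \qquad \mathcal{A}_N(x) := \#\{1 \le n \le N : x_n < x\}.$$ $\log$ denotes the natural logarithm. *)

theory Defs
  imports Complex_Main "HOL-Library.Liminf_Limsup" "HOL-Library.Extended_Real"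
begin

text \<open>
  Sequences \<open>x\<^sub>1, x\<^sub>2, \<dots>\<close> are functions on \<^typ>\<open>nat\<close> of which only the values at
  indices \<open>\<ge> 1\<close> matter; the value at \<open>0\<close> is never used.
\<close>

definition unit_seqs :: "(nat \<Rightarrow> real) set" where
  "unit_seqs = {w. \<forall>n\<ge>1. w n \<in> {0..<1}}"

definition count_below :: "(nat \<Rightarrow> real) \<Rightarrow> nat \<Rightarrow> real \<Rightarrow> nat" where
  "count_below w N x = card {n \<in> {1..N}. w n < x}"

definition star_discrepancy :: "(nat \<Rightarrow> real) \<Rightarrow> nat \<Rightarrow> real" where
  "star_discrepancy w N = (SUP x\<in>{0..1}. \<bar>real (count_below w N x) / real N - x\<bar>)"

text \<open>
  The limsup may be infinite for some sequences, hence it is taken in \<^typ>\<open>ereal\<close>.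
  The junk values of the quotient at \<open>N = 0\<close> and \<open>N = 1\<close> do not affect it.
\<close>

definition c_star :: ereal where
  "c_star = (INF w\<in>unit_seqs.
     limsup (\<lambda>N. ereal (real N * star_discrepancy w N / ln (real N))))"

end

theory Submission imports Defs "HOL-Analysis.Analysis" begin

text \<open>
  Put \<open>\<Delta>\<^sub>n(x) = A\<^sub>n(x) - n x\<close> and let \<open>G(N)\<close> be the integral over \<open>x\<close> of
  \<open>max\<^sub>n\<^sub>\<le>\<^sub>N \<Delta>\<^sub>n(x) - min\<^sub>n\<^sub>\<le>\<^sub>N \<Delta>\<^sub>n(x)\<close>; it is at most twice the largest \<open>n D\<^sub>n\<^sup>*\<close>.
  Comparing the block \<open>{0..4T}\<close> with its first and last quarter through
  \<open>max(p,q) - min(r,s) = ((p-r) + (q-s) + |p-q| + |r-s|)/2\<close> shows that \<open>G(4T)\<close> exceeds the average of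
  the values of \<open>G\<close> for the two quarters by \<open>(\<integral>|p-q| + \<integral>|r-s|)/2\<close>, so it suffices that
  both integrals are at least \<open>23/128\<close> (the second one is the first one for the sequence \<open>1 - w\<close>).

  Here \<open>f = q - p\<close> is the difference of the maxima of \<open>\<Delta>\<^sub>n(x)\<close> over the last and the first quarter, attained at
  \<open>n = n(x)\<close> and \<open>m = m(x)\<close>. As \<open>x\<close> grows, \<open>f\<close> decreases with slope \<open>n - m \<in> [2T, 4T]\<close> and
  jumps up at the points of the sequence: by exactly \<open>1\<close> at the \<open>2T\<close> points of the two middle quarters,
  by some amount in \<open>[0,1]\<close> at the others. Being maximisers of families of lines, \<open>n\<close> and \<open>m\<close>
  can only decrease, except that \<open>n\<close> may increase at a point of the last quarter and \<open>m\<close> at a point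
  of the first quarter. A potential \<open>W(f, n/T, m/T)\<close> turns this into the bound: along the descents it
  decreases at rate at most \<open>T (|f| - 1/4)\<close>, it drops by at most \<open>1/256\<close> at a point of the middle quarters and
  by at most \<open>1/32\<close> at the others. Since it has the same value at \<open>0\<close> and at \<open>1\<close>, we get
  \<open>\<integral>|f| \<ge> 1/4 - 2/256 - 2/32 = 23/128\<close>. The resulting constant is \<open>23/(256 ln 4) > 0.0648\<close>.
\<close>

section \<open>The potential\<close>

text \<open>For c >= 0 an odd antiderivative of 2 max(0, |y| - c); combinations of these have
  piecewise linear derivatives with prescribed kinks.\<close>

definition tsq :: "real \<Rightarrow> real \<Rightarrow> real" where
  "tsq c y = (max 0 (y - c))\<^sup>2 - (max 0 (- y - c))\<^sup>2"

text \<open>Antiderivative of |y| - 1/4, the rate granted to the potential along descents.\<close>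

definition drift :: "real \<Rightarrow> real" where
  "drift y = tsq 0 y / 2 - y / 4"

text \<open>
  With \<open>s = n/T - m/T \<in> [2,4]\<close>, the potential is \<open>W = P(f) + s Q(f) - (n + m)/(256 T)\<close>. Along a descent
  the requirement is \<open>s P'(y) + s\<^sup>2 Q'(y) \<le> |y| - 1/4\<close>. For \<open>|y| \<le> 1/4\<close> the choice
  \<open>P' = 3/4 (|y| - 1/4)\<close>, \<open>Q' = - (|y| - 1/4)/8\<close> gives equality at \<open>s = 2\<close> and \<open>s = 4\<close>; for
  \<open>1/4 \<le> |y| \<le> 1/2\<close> the same \<open>Q'\<close> allows \<open>P' = 11/16 (|y| - 1/4)\<close>, close to the optimal factor
  \<open>1/\<surd>2\<close>. Up to \<open>|y| = 3/4\<close> the function \<open>Q\<close> continues with period \<open>1\<close>, so that a unit jump from near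
  \<open>-1/2\<close> to near \<open>1/2\<close> does not change it; beyond that \<open>Q\<close> is constant and \<open>P' = 1/8\<close>.
\<close>

definition potP :: "real \<Rightarrow> real" where
  "potP y = 3/4 * drift y - tsq (1/4) y / 32 - 7/16 * tsq (1/2) y + 3/32 * tsq (3/4) y"

definition potQ :: "real \<Rightarrow> real" where
  "potQ y = - drift y / 8 + tsq (1/2) y / 8 - tsq (3/4) y / 16"

definition pot :: "real \<Rightarrow> real \<Rightarrow> real" where
  "pot s y = potP y + s * potQ y"

section \<open>Derivatives of the potential\<close>

lemma has_real_derivative_mult_abs:
  "((\<lambda>x::real. x * \<bar>x\<bar>) has_real_derivative 2 * \<bar>x\<bar>) (at x)"
proof -
  consider "x < 0" | "x > 0" | "x = 0" by linarith
  then show ?thesis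
  proof cases
    case 1
    have "((\<lambda>x. - (x * x)) has_real_derivative 2 * \<bar>x\<bar>) (at x)"
      using 1 by (auto intro!: derivative_eq_intros)
    then show ?thesis
      by (rule DERIV_cong_ev[THEN iffD1, rotated -1])
         (use 1 in \<open>auto simp: eventually_nhds intro: exI[of _ "{..<0}"]\<close>)
  next
    case 2
    have "((\<lambda>x. x * x) has_real_derivative 2 * \<bar>x\<bar>) (at x)"
      using 2 by (auto intro!: derivative_eq_intros)
    then show ?thesis
      by (rule DERIV_cong_ev[THEN iffD1, rotated -1])
         (use 2 in \<open>auto simp: eventually_nhds intro: exI[of _ "{0<..}"]\<close>)
  next
    case 3
    have "((\<lambda>h::real. \<bar>h\<bar>) \<longlongrightarrow> 0) (at 0)"
      by (auto intro!: tendsto_eq_intros)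
    then have "((\<lambda>h::real. ((0 + h) * \<bar>0 + h\<bar> - 0 * \<bar>0\<bar>) / h) \<longlongrightarrow> 0) (at 0)"
      by (rule Lim_transform_eventually) (auto simp: eventually_at_filter)
    then show ?thesis
      using 3 by (simp add: DERIV_def)
  qed
qed

text \<open>Since (max 0 z)^2 = (z^2 + z|z|)/2, differentiability at the kinks reduces to that of
  z|z|.\<close>

lemma tsq_eq: "tsq c y = ((y - c)\<^sup>2 + (y - c) * \<bar>y - c\<bar> - (y + c)\<^sup>2 + (y + c) * \<bar>y + c\<bar>) / 2"
  by (auto simp: tsq_def max_def abs_if power2_eq_square algebra_simps)

lemma DERIV_tsq:
  assumes "c \<ge> 0"
  shows "(tsq c has_real_derivative 2 * max 0 (\<bar>y\<bar> - c)) (at y)"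
proof -
  note D = has_real_derivative_mult_abs
  have D1: "((\<lambda>y. (y - c) * \<bar>y - c\<bar>) has_real_derivative 2 * \<bar>y - c\<bar> * 1) (at y)"
    by (rule DERIV_chain'[OF _ D]) (auto intro!: derivative_eq_intros)
  have D2: "((\<lambda>y. (y + c) * \<bar>y + c\<bar>) has_real_derivative 2 * \<bar>y + c\<bar> * 1) (at y)"
    by (rule DERIV_chain'[OF _ D]) (auto intro!: derivative_eq_intros)
  have "((\<lambda>y. ((y - c)\<^sup>2 + (y - c) * \<bar>y - c\<bar> - (y + c)\<^sup>2 + (y + c) * \<bar>y + c\<bar>) / 2)
    has_real_derivative 2 * max 0 (\<bar>y\<bar> - c)) (at y)"
    by (rule derivative_eq_intros D1 D2 refl)+ (use assms in \<open>auto simp: max_def abs_if algebra_simps\<close>)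
  then show ?thesis
    unfolding tsq_eq[abs_def] .
qed

lemma tsq_minus: "tsq c (- y) = - tsq c y"
  by (simp add: tsq_def)

lemma drift_minus: "drift (- y) = - drift y"
  by (simp add: drift_def tsq_minus)

lemma potQ_minus: "potQ (- y) = - potQ y"
  by (simp add: potQ_def drift_minus tsq_minus)

lemma pot_minus: "pot s (- y) = - pot s y"
  by (simp add: pot_def potP_def potQ_def drift_minus tsq_minus algebra_simps)

lemma DERIV_drift: "(drift has_real_derivative \<bar>y\<bar> - 1/4) (at y)"
  unfolding drift_def[abs_def]
  by (auto intro!: derivative_eq_intros DERIV_tsq)

lemma DERIV_pot:
  "(pot s has_real_derivative
     (3/4 - s/8) * (\<bar>y\<bar> - 1/4) - max 0 (\<bar>y\<bar> - 1/4) / 16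
     + (s/4 - 7/8) * max 0 (\<bar>y\<bar> - 1/2) + (3/16 - s/8) * max 0 (\<bar>y\<bar> - 3/4)) (at y)"
  unfolding pot_def[abs_def] potP_def potQ_def
  by (rule derivative_eq_intros DERIV_tsq DERIV_drift refl | simp add: field_simps)+

text \<open>Integrated form of s pot' <= |y| - 1/4. The difference of the two sides is linear in |y|
  between the kinks 1/4, 1/2, 3/4, so each piece is checked separately.\<close>

lemma pot_increment_le:
  assumes s: "2 \<le> s" "s \<le> 4" and uv: "u \<le> v"
  shows "s * (pot s v - pot s u) \<le> drift v - drift u"
proof -
  have "drift u - s * pot s u \<le> drift v - s * pot s v"
  proof (rule DERIV_nonneg_imp_nondecreasing[OF uv])
    fix y :: real
    let ?r = "\<bar>y\<bar>"
    let ?D = "(3/4 - s/8) * (?r - 1/4) - max 0 (?r - 1/4) / 16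
     + (s/4 - 7/8) * max 0 (?r - 1/2) + (3/16 - s/8) * max 0 (?r - 3/4)"
    have D: "((\<lambda>y. drift y - s * pot s y) has_real_derivative (?r - 1/4) - s * ?D) (at y)"
      by (rule derivative_eq_intros DERIV_pot DERIV_drift refl | simp)+
    \<comment> \<open>The discriminant is (11/16)^2 - 1/2 < 0; this is where 11/16 < 1/sqrt 2
      enters.\<close>
    have q: "0 \<le> 1 - 11/16 * s + s * s / 8"
      using zero_le_square[of "s - 11/4"] by (simp add: algebra_simps)
    consider "?r \<le> 1/4" | "1/4 \<le> ?r" "?r \<le> 1/2" | "1/2 \<le> ?r" "?r \<le> 3/4" | "3/4 \<le> ?r"
      by linarith
    then have "0 \<le> (?r - 1/4) - s * ?D"
    proof cases
      case 1
      have "0 \<le> (1/4 - ?r) * ((s - 2) * (4 - s)) / 8"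
        using 1 s by (intro divide_nonneg_nonneg mult_nonneg_nonneg) auto
      also have "\<dots> = (?r - 1/4) - s * ?D"
        using 1 by (simp add: max_def field_simps)
      finally show ?thesis .
    next
      case 2
      have "0 \<le> (?r - 1/4) * (1 - 11/16 * s + s * s / 8)"
        using 2 q by (intro mult_nonneg_nonneg) auto
      also have "\<dots> = (?r - 1/4) - s * ?D"
        using 2 by (auto simp: max_def field_simps)
      finally show ?thesis .
    next
      case 3
      \<comment> \<open>Linear in |y|, hence an interpolation between the values at 1/2 and
        3/4.\<close>
      have "0 \<le> (3/4 - ?r) * (1 - 11/16 * s + s * s / 8) + (?r - 1/2) * (2 - s/2)"
        using 3 q s by (auto intro: add_nonneg_nonneg[OF mult_nonneg_nonneg mult_nonneg_nonneg])
      also have "\<dots> = (?r - 1/4) - s * ?D"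
        using 3 by (auto simp: max_def field_simps)
      finally show ?thesis .
    next
      case 4
      have "0 \<le> (?r - 3/4) + (4 - s) / 8"
        using 4 s by auto
      also have "\<dots> = (?r - 1/4) - s * ?D"
        using 4 by (auto simp: max_def field_simps)
      finally show ?thesis .
    qed
    then show "\<exists>D. ((\<lambda>y. drift y - s * pot s y) has_real_derivative D) (at y) \<and> 0 \<le> D"
      using D by blast
  qed
  then show ?thesis
    by (simp add: algebra_simps)
qed

text \<open>Upward jumps within this range do not lower the potential; by oddness the same holds
  below -1/2.\<close>

lemma pot_mono_outer:
  assumes s: "2 \<le> s" "s \<le> 4" and uv: "1/2 \<le> u" "u \<le> v"
  shows "pot s u \<le> pot s v"
proof (rule DERIV_nonneg_imp_nondecreasing[OF \<open>u \<le> v\<close>])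
  fix y assume "u \<le> y" "y \<le> v"
  then have y: "1/2 \<le> y" using uv by simp
  let ?D = "(3/4 - s/8) * (\<bar>y\<bar> - 1/4) - max 0 (\<bar>y\<bar> - 1/4) / 16
     + (s/4 - 7/8) * max 0 (\<bar>y\<bar> - 1/2) + (3/16 - s/8) * max 0 (\<bar>y\<bar> - 3/4)"
  have "0 \<le> ?D"
  proof (cases "y \<le> 3/4")
    case True
    have "0 \<le> (y - 1/2) / 2 + (3/4 - y) * (11/16 - s/8)"
      using True y s by (intro add_nonneg_nonneg mult_nonneg_nonneg) auto
    also have "\<dots> = ?D"
      using True y by (auto simp: max_def field_simps)
    finally show ?thesis .
  next
    case False
    then have "?D = 1/8" by (auto simp: max_def field_simps)
    then show ?thesis by simp
  qed
  then show "\<exists>D. (pot s has_real_derivative D) (at y) \<and> 0 \<le> D"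
    using DERIV_pot by blast
qed


text \<open>The extreme values occur at |y| = 1/4 and for |y| >= 3/4. This bound dictates the
  coefficient 1/256 of n + m in \<open>potW\<close>.\<close>

lemma abs_potQ_le: "\<bar>potQ y\<bar> \<le> 1/256"
proof -
  have *: "\<bar>potQ y\<bar> \<le> 1/256" if "0 \<le> y" for y
  proof -
    consider "y \<le> 1/2" | "1/2 \<le> y" "y \<le> 3/4" | "3/4 \<le> y" by linarith
    then show ?thesis
    proof cases
      case 1
      have "potQ y = 1/256 - (y - 1/4)\<^sup>2 / 16"
        using 1 that by (auto simp: potQ_def drift_def tsq_def max_def power2_eq_square field_simps)
      moreover have "(y - 1/4)\<^sup>2 \<le> (1/4)\<^sup>2"
        using mult_nonneg_nonneg[of y "1/2 - y"] 1 that by (simp add: power2_eq_square algebra_simps)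
      ultimately show ?thesis
        using zero_le_power2[of "y - 1/4"] by (simp add: power2_eq_square)
    next
      case 2
      have "potQ y = (y - 3/4)\<^sup>2 / 16 - 1/256"
        using 2 by (auto simp: potQ_def drift_def tsq_def max_def power2_eq_square field_simps)
      moreover have "(y - 3/4)\<^sup>2 \<le> (1/4)\<^sup>2"
        using 2 by (intro power2_le_iff_abs_le[THEN iffD2]) auto
      ultimately show ?thesis
        using zero_le_power2[of "y - 3/4"] by (simp add: power2_eq_square)
    next
      case 3
      then show ?thesis
        by (auto simp: potQ_def drift_def tsq_def max_def power2_eq_square field_simps)
    qed
  qed
  show ?thesis
    using *[of y] *[of "- y"] by (cases "0 \<le> y") (auto simp: potQ_minus)
qed

section \<open>Extremes of the potential and the cost of jumps\<close>

lemma pot_inner: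
  assumes "0 \<le> y" "y \<le> 1/2"
  shows "pot s y = (3/4 - s/8) * ((y - 1/4)\<^sup>2 / 2 - 1/32) - (max 0 (y - 1/4))\<^sup>2 / 32"
  using assms
  by (auto simp: pot_def potP_def potQ_def drift_def tsq_def max_def power2_eq_square field_simps)

lemma pot_inner_bounds:
  assumes s: "2 \<le> s" "s \<le> 4" and y: "0 \<le> y" "y \<le> 1/2"
  shows "- (6 - s) / 256 \<le> pot s y" "pot s y \<le> 0"
proof -
  let ?z = "(y - 1/4)\<^sup>2" and ?m = "(max 0 (y - 1/4))\<^sup>2"
  have m: "0 \<le> ?m" "?m \<le> ?z"
    by (auto simp: max_def)
  have z: "?z \<le> (1/4)\<^sup>2"
    using mult_nonneg_nonneg[of y "1/2 - y"] y by (simp add: power2_eq_square algebra_simps)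
  \<comment> \<open>As s <= 4, the coefficient of \<open>?z\<close> is at least 1/8, which absorbs
    the correction \<open>?m / 32\<close>; the minimum is thus the value at y = 1/4.\<close>
  have "0 \<le> (1/4 - s/16) * ?z"
    using s by auto
  then have "?z / 8 - (6 - s) / 256 \<le> (3/4 - s/8) * (?z / 2 - 1/32)"
    by (simp add: algebra_simps diff_divide_distrib)
  then show "- (6 - s) / 256 \<le> pot s y"
    unfolding pot_inner[OF y] using m by linarith
  have "(3/4 - s/8) * (?z / 2 - 1/32) \<le> 0"
    using s z by (intro mult_nonneg_nonpos) (auto simp: power2_eq_square)
  then show "pot s y \<le> 0"
    unfolding pot_inner[OF y] using m by linarith
qed

text \<open>By oddness the minimum at 1/4 becomes a maximum at -1/4; left of -1/2 monotonicity takes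
  over.\<close>

lemma pot_upper_bound:
  assumes s: "2 \<le> s" "s \<le> 4" and y: "y \<le> 1/2"
  shows "pot s y \<le> (6 - s) / 256"
proof -
  consider "0 \<le> y" | "- 1/2 \<le> y" "y \<le> 0" | "y \<le> - 1/2" by linarith
  then show ?thesis
  proof cases
    case 1
    then show ?thesis using pot_inner_bounds(2)[OF s 1 y] s by simp
  next
    case 2
    then show ?thesis using pot_inner_bounds(1)[OF s, of "- y"] by (simp add: pot_minus)
  next
    case 3
    have "- pot s y \<ge> pot s (1/2)"
      using pot_mono_outer[OF s, of "1/2" "- y"] 3 by (simp add: pot_minus)
    then show ?thesis using pot_inner_bounds(1)[OF s, of "1/2"] by simp
  qed
qed

text \<open>The worst case is the symmetric jump from -1/2 to 1/2, which costs exactly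
  1/256.\<close>

lemma pot_unit_jump:
  assumes s: "2 \<le> s" "s \<le> 4"
  shows "pot s y \<le> 1/256 + pot s (y + 1)"
proof -
  have *: "pot s y \<le> 1/256 + pot s (y + 1)" if "- 1/2 \<le> y" for y
  proof -
    consider "y \<le> - 1/4" | "- 1/4 \<le> y" "y \<le> 1/2" | "1/2 \<le> y" by linarith
    then show ?thesis
    proof cases
      case 1
      \<comment> \<open>\<open>potQ\<close> takes the same value at both ends of the jump, so s
        cancels.\<close>
      have "pot s (y + 1) - pot s y = (y + 1/2)\<^sup>2 / 4 - 1/256"
        using 1 that
        by (auto simp: pot_def potP_def potQ_def drift_def tsq_def max_def power2_eq_square field_simps)
      then show ?thesis using zero_le_power2[of "y + 1/2"] by linarith
    next
      case 2
      \<comment> \<open>The jump ends beyond 3/4 and starts at a value of at most (6 - s)/256, so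
        the potential even grows by at least 3/256.\<close>
      have "pot s (3/4) = 9/256 - s/256"
        by (auto simp: pot_def potP_def potQ_def drift_def tsq_def max_def power2_eq_square field_simps)
      then show ?thesis
        using pot_mono_outer[OF s, of "3/4" "y + 1"] pot_upper_bound[OF s, of y] 2 by simp
    next
      case 3
      then show ?thesis using pot_mono_outer[OF s, of y "y + 1"] by simp
    qed
  qed
  show ?thesis
  proof (cases "- 1/2 \<le> y")
    case False
    \<comment> \<open>Oddness turns the jump from y to y + 1 into the one from -(y + 1) to -y, whose
      start lies above -1/2.\<close>
    then have "pot s (- (y + 1)) \<le> 1/256 + pot s (- y)"
      using *[of "- (y + 1)"] by simp
    then show ?thesis unfolding pot_minus by simp
  qed (rule *)
qed

text \<open>Both the size of the jump and the change of slope are arbitrary. Outside [-1/2, 1/2]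
  monotonicity leaves only the change of slope to pay, at most 1/256; otherwise the two extremes add
  up to (12 - s - s')/256.\<close>

lemma pot_partial_jump:
  assumes s: "2 \<le> s" "s \<le> 4" and s': "2 \<le> s'" "s' \<le> 4"
    and ss': "5 \<le> s + s'" "\<bar>s - s'\<bar> \<le> 1" and yz: "y \<le> z"
  shows "pot s y \<le> 7/256 + pot s' z"
proof -
  have Q: "\<bar>(s - s') * potQ z\<bar> \<le> 1 * (1/256)"
    unfolding abs_mult using ss' abs_potQ_le[of z] by (intro mult_mono) auto
  have step: "pot s y \<le> 7/256 + pot s' z" if "pot s y \<le> pot s z"
    using that abs_ge_self[of "(s - s') * potQ z"] Q by (simp add: pot_def left_diff_distrib)
  consider "1/2 \<le> y" | "z \<le> - 1/2" | "y \<le> 1/2" "- 1/2 \<le> z" by linarith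
  then show ?thesis
  proof cases
    case 1
    then show ?thesis using step pot_mono_outer[OF s, of y z] yz by simp
  next
    case 2
    then show ?thesis
      using step pot_mono_outer[OF s, of "- z" "- y"] yz by (simp add: pot_minus)
  next
    case 3
    have "pot s y \<le> (6 - s) / 256" "- pot s' z \<le> (6 - s') / 256"
      using pot_upper_bound[OF s, of y] pot_upper_bound[OF s', of "- z"] 3
      by (auto simp: pot_minus)
    then show ?thesis using ss' by simp
  qed
qed

section \<open>The potential as a function of the scaled indices\<close>

definition potW :: "real \<Rightarrow> real \<Rightarrow> real \<Rightarrow> real" where
  "potW y n m = pot (n - m) y - (n + m) / 256"

text \<open>W is affine in n and m with slopes \<open>potQ y - 1/256\<close> and
  \<open>- potQ y - 1/256\<close>, both nonpositive. So a maximiser moving to a smaller index costs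
  nothing.\<close>

lemma potW_antimono:
  assumes "n' \<le> n" "m' \<le> m"
  shows "potW y n m \<le> potW y n' m'"
proof -
  have "(n - n') * (potQ y - 1/256) \<le> 0"
    using assms abs_potQ_le[of y] by (intro mult_nonneg_nonpos) auto
  moreover have "(m - m') * (- potQ y - 1/256) \<le> 0"
    using assms abs_potQ_le[of y] by (intro mult_nonneg_nonpos) auto
  ultimately show ?thesis
    by (simp add: potW_def pot_def field_simps)
qed

lemma potW_unit_jump:
  assumes "3 \<le> n" "n \<le> 4" "0 \<le> m" "m \<le> 1"
  shows "potW y n m \<le> 1/256 + potW (y + 1) n m"
  using pot_unit_jump[of "n - m" y] assms by (simp add: potW_def)

text \<open>The worst index change is from 3 to 4: 7/256 for the jump of \<open>pot\<close> and
  1/256 for the linear term.\<close>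

lemma potW_partial_jump_last:
  assumes "3 \<le> n" "n' \<le> 4" "0 \<le> m" "m \<le> 1" "y \<le> z"
  shows "potW y n m \<le> 1/32 + potW z n' m"
proof -
  have "potW y n m \<le> potW y 3 m" using assms by (intro potW_antimono) auto
  also have "\<dots> \<le> 1/32 + potW z 4 m"
    using pot_partial_jump[of "3 - m" "4 - m" y z] assms by (simp add: potW_def add_divide_distrib)
  also have "potW z 4 m \<le> potW z n' m" using assms by (intro potW_antimono) auto
  finally show ?thesis by simp
qed

lemma potW_partial_jump_first:
  assumes "0 \<le> m" "m' \<le> 1" "3 \<le> n" "n \<le> 4" "y \<le> z"
  shows "potW y n m \<le> 1/32 + potW z n m'"
proof -
  have "potW y n m \<le> potW y n 0" using assms by (intro potW_antimono) auto
  also have "\<dots> \<le> 1/32 + potW z n 1"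
    using pot_partial_jump[of n "n - 1" y z] assms by (simp add: potW_def add_divide_distrib)
  also have "potW z n 1 \<le> potW z n m'" using assms by (intro potW_antimono) auto
  finally show ?thesis by simp
qed

section \<open>Maxima of discrepancy functions\<close>

definition disc_fun :: "(nat \<Rightarrow> real) \<Rightarrow> nat \<Rightarrow> real \<Rightarrow> real" where
  "disc_fun w n x = real (count_below w n x) - real n * x"

definition top_disc :: "(nat \<Rightarrow> real) \<Rightarrow> nat set \<Rightarrow> real \<Rightarrow> real" where
  "top_disc w I x = Max ((\<lambda>n. disc_fun w n x) ` I)"

text \<open>Ties go to the largest index: with slopes -n it leads just to the left of x, which makes
  the index left-continuous.\<close>

definition top_index :: "(nat \<Rightarrow> real) \<Rightarrow> nat set \<Rightarrow> real \<Rightarrow> nat" where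
  "top_index w I x = Max {n \<in> I. disc_fun w n x = top_disc w I x}"

lemma Max_image_eqI:
  assumes "finite I" "N \<in> I" "\<And>n. n \<in> I \<Longrightarrow> a n \<le> (a N :: real)"
  shows "Max (a ` I) = a N"
  using assms by (intro Max_eqI) auto

lemma top_index_props:
  assumes "finite I" "I \<noteq> {}"
  shows "top_index w I x \<in> I" "disc_fun w (top_index w I x) x = top_disc w I x"
    "\<And>n. n \<in> I \<Longrightarrow> disc_fun w n x = top_disc w I x \<Longrightarrow> n \<le> top_index w I x"
proof -
  let ?S = "{n \<in> I. disc_fun w n x = top_disc w I x}"
  have "top_disc w I x \<in> (\<lambda>n. disc_fun w n x) ` I"
    unfolding top_disc_def using assms by (intro Max_in) auto
  then have "?S \<noteq> {}" by force
  then have "Max ?S \<in> ?S" using assms by (intro Max_in) auto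
  then show "top_index w I x \<in> I" "disc_fun w (top_index w I x) x = top_disc w I x"
    by (auto simp: top_index_def)
  show "\<And>n. n \<in> I \<Longrightarrow> disc_fun w n x = top_disc w I x \<Longrightarrow> n \<le> top_index w I x"
    unfolding top_index_def using assms by (intro Max_ge) auto
qed

lemma disc_fun_le_top: "finite I \<Longrightarrow> n \<in> I \<Longrightarrow> disc_fun w n x \<le> top_disc w I x"
  by (auto simp: top_disc_def)

lemma top_index_eqI:
  assumes "finite I" "N \<in> I" "\<And>n. n \<in> I \<Longrightarrow> n \<noteq> N \<Longrightarrow> disc_fun w n x < disc_fun w N x"
  shows "top_index w I x = N" "top_disc w I x = disc_fun w N x"
proof -
  show "top_disc w I x = disc_fun w N x"
    unfolding top_disc_def using assms by (intro Max_image_eqI) (auto intro: less_imp_le)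
  then show "top_index w I x = N"
    using top_index_props(1,2)[of I w x] assms by force
qed

text \<open>Among finitely many lines with distinct slopes, the lexicographic maximum of (a, c)
  leads strictly just right of 0. It serves left neighbourhoods with c = n and right ones with c =
  -n.\<close>

lemma eventual_leader:
  fixes a c :: "nat \<Rightarrow> real"
  assumes I: "finite I" "I \<noteq> {}" and inj: "inj_on c I"
  obtains N where "N \<in> I" "\<And>n. n \<in> I \<Longrightarrow> a n \<le> a N"
    "\<And>n. n \<in> I \<Longrightarrow> a n = a N \<Longrightarrow> c n \<le> c N"
    "\<forall>\<^sub>F h in at_right 0. \<forall>n\<in>I. n \<noteq> N \<longrightarrow> a n + c n * h < a N + c N * h"
proof -
  define S where "S = {n \<in> I. a n = Max (a ` I)}"
  have "Max (a ` I) \<in> a ` I" using I by (intro Max_in) auto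
  then have S: "finite S" "S \<noteq> {}" using I by (force simp: S_def)+
  then have "Max (c ` S) \<in> c ` S" by (intro Max_in) auto
  then obtain N where N: "N \<in> S" "c N = Max (c ` S)" by force
  have a: "a n \<le> a N" if "n \<in> I" for n
    using N that I by (auto simp: S_def)
  have c: "c n \<le> c N" if "n \<in> I" "a n = a N" for n
    using N that S by (auto simp: S_def)
  have "\<forall>\<^sub>F h in at_right 0. n \<noteq> N \<longrightarrow> a n + c n * h < a N + c N * h" if n: "n \<in> I" for n
  proof (cases "n = N \<or> a n < a N")
    case True
    have "((\<lambda>h. (a N + c N * h) - (a n + c n * h)) \<longlongrightarrow> a N - a n) (at_right 0)"
      by (auto intro!: tendsto_eq_intros)
    then have "\<forall>\<^sub>F h in at_right 0. 0 < (a N + c N * h) - (a n + c n * h)" if "a n < a N"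
      by (rule order_tendstoD(1)) (use that in simp)
    then show ?thesis using True by (auto elim: eventually_mono)
  next
    case False
    then have eq: "a n = a N" using a[OF n] by simp
    have "N \<in> I" using N by (simp add: S_def)
    then have "c n \<noteq> c N" using inj_onD[OF inj _ n] False by blast
    then have less: "c n < c N" using c[OF n eq] by simp
    have "\<forall>\<^sub>F h::real in at_right 0. 0 < h"
      by (simp add: eventually_at_right_less)
    then show ?thesis
      by eventually_elim (simp add: eq less)
  qed
  then have "\<forall>\<^sub>F h in at_right 0. \<forall>n\<in>I. n \<noteq> N \<longrightarrow> a n + c n * h < a N + c N * h"
    using I by (intro eventually_ball_finite) auto
  then show ?thesis
    using that[of N] a c N by (auto simp: S_def)
qed

section \<open>One-sided behaviour of the maxima\<close>

lemma finite_gap_left: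
  fixes A :: "real set"
  assumes "finite A"
  shows "\<forall>\<^sub>F h in at_right 0. \<forall>z\<in>A. \<not> (x - h \<le> z \<and> z < x)"
proof (rule eventually_ball_finite[OF assms], rule ballI)
  fix z assume "z \<in> A"
  show "\<forall>\<^sub>F h in at_right 0. \<not> (x - h \<le> z \<and> z < x)"
  proof (cases "z < x")
    case True
    then have "\<forall>\<^sub>F h in at_right 0. h < x - z"
      by (intro order_tendstoD(2)[OF tendsto_ident_at]) auto
    then show ?thesis by eventually_elim auto
  qed auto
qed

lemma finite_gap_right:
  fixes A :: "real set"
  assumes "finite A"
  shows "\<forall>\<^sub>F h in at_right 0. \<forall>z\<in>A. \<not> (x < z \<and> z < x + h)"
proof (rule eventually_ball_finite[OF assms], rule ballI)
  fix z assume "z \<in> A"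
  show "\<forall>\<^sub>F h in at_right 0. \<not> (x < z \<and> z < x + h)"
  proof (cases "x < z")
    case True
    then have "\<forall>\<^sub>F h in at_right 0. h < z - x"
      by (intro order_tendstoD(2)[OF tendsto_ident_at]) auto
    then show ?thesis by eventually_elim auto
  qed auto
qed

lemma disc_fun_left:
  assumes "\<forall>z\<in>w ` {1..M}. \<not> (x - h \<le> z \<and> z < x)" "n \<le> M" "0 \<le> h"
  shows "disc_fun w n (x - h) = disc_fun w n x + real n * h"
proof -
  \<comment> \<open>The gap must exclude a point at x - h itself, since \<open>count_below\<close>
    counts strictly.\<close>
  have "w k < x - h \<longleftrightarrow> w k < x" if "k \<in> {1..n}" for k
  proof -
    have "w k \<in> w ` {1..M}" using that assms(2) by auto
    then show ?thesis using assms(1,3) by force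
  qed
  then have "{k \<in> {1..n}. w k < x - h} = {k \<in> {1..n}. w k < x}" by auto
  then show ?thesis by (simp add: disc_fun_def count_below_def algebra_simps)
qed

text \<open>A point equal to x is counted only to the right of x, whence the additional
  cardinality.\<close>

lemma disc_fun_right:
  assumes "\<forall>z\<in>w ` {1..M}. \<not> (x < z \<and> z < x + h)" "n \<le> M" "0 < h"
  shows "disc_fun w n (x + h) = disc_fun w n x + real (card {k \<in> {1..n}. w k = x}) + - real n * h"
proof -
  have *: "w k < x + h \<longleftrightarrow> w k < x \<or> w k = x" if "k \<in> {1..n}" for k
  proof -
    have "w k \<in> w ` {1..M}" using that assms(2) by auto
    then show ?thesis using assms(1,3) by force
  qed
  have "{k \<in> {1..n}. w k < x + h} = {k \<in> {1..n}. w k < x} \<union> {k \<in> {1..n}. w k = x}"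
    using * by blast
  moreover have "card ({k \<in> {1..n}. w k < x} \<union> {k \<in> {1..n}. w k = x})
      = card {k \<in> {1..n}. w k < x} + card {k \<in> {1..n}. w k = x}"
    by (intro card_Un_disjoint) auto
  ultimately show ?thesis by (simp add: disc_fun_def count_below_def algebra_simps)
qed

lemma top_disc_left:
  assumes I: "I \<noteq> {}" "I \<subseteq> {..M}"
  shows "\<forall>\<^sub>F h in at_right 0. top_index w I (x - h) = top_index w I x \<and>
     top_disc w I (x - h) = top_disc w I x + real (top_index w I x) * h"
proof -
  have fin: "finite I" using I finite_subset by blast
  obtain N where N: "N \<in> I" "\<And>n. n \<in> I \<Longrightarrow> disc_fun w n x \<le> disc_fun w N x"
    "\<And>n. n \<in> I \<Longrightarrow> disc_fun w n x = disc_fun w N x \<Longrightarrow> real n \<le> real N"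
    and ev: "\<forall>\<^sub>F h in at_right 0. \<forall>n\<in>I. n \<noteq> N \<longrightarrow> disc_fun w n x + real n * h < disc_fun w N x + real N * h"
    by (rule eventual_leader[OF fin I(1), of real "\<lambda>n. disc_fun w n x"]) (auto simp: inj_on_def)
  have top: "top_disc w I x = disc_fun w N x"
    unfolding top_disc_def using N fin by (intro Max_image_eqI) auto
  have "top_index w I x = N"
    using top_index_props[OF fin I(1), where w = w and x = x] N top by (metis le_antisym of_nat_le_iff)
  note eqs = top this
  have gap: "\<forall>\<^sub>F h in at_right 0. \<forall>z\<in>w ` {1..M}. \<not> (x - h \<le> z \<and> z < x)"
    by (rule finite_gap_left) auto
  have pos: "\<forall>\<^sub>F h::real in at_right 0. 0 < h"
    by (simp add: eventually_at_right_less)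
  show ?thesis
    using ev gap pos
  proof eventually_elim
    case (elim h)
    have d: "disc_fun w n (x - h) = disc_fun w n x + real n * h" if "n \<in> I" for n
      using disc_fun_left[OF elim(2), of n] I that elim(3) by auto
    show ?case
      using top_index_eqI[OF fin N(1), where w = w and x = "x - h"] elim(1) N(1) by (auto simp: d eqs)
  qed
qed

text \<open>To the right of x the smallest of the tied indices leads, because its line falls most
  slowly; \<open>a\<close> is the right limit.\<close>

lemma top_disc_right:
  fixes w :: "nat \<Rightarrow> real" and x :: real
  assumes I: "I \<noteq> {}" "I \<subseteq> {..M}"
  defines "a \<equiv> \<lambda>n. disc_fun w n x + real (card {k \<in> {1..n}. w k = x})"
  obtains N where "N \<in> I" "\<And>n. n \<in> I \<Longrightarrow> a n \<le> a N" "\<And>n. n \<in> I \<Longrightarrow> a n = a N \<Longrightarrow> N \<le> n"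
    "\<forall>\<^sub>F h in at_right 0. top_index w I (x + h) = N \<and> top_disc w I (x + h) = a N - real N * h"
proof -
  have fin: "finite I" using I finite_subset by blast
  obtain N where N: "N \<in> I" "\<And>n. n \<in> I \<Longrightarrow> a n \<le> a N"
    "\<And>n. n \<in> I \<Longrightarrow> a n = a N \<Longrightarrow> - real n \<le> - real N"
    and ev: "\<forall>\<^sub>F h in at_right 0. \<forall>n\<in>I. n \<noteq> N \<longrightarrow> a n + - real n * h < a N + - real N * h"
    by (rule eventual_leader[OF fin I(1), of "\<lambda>n. - real n" a]) (auto simp: inj_on_def)
  have gap: "\<forall>\<^sub>F h in at_right 0. \<forall>z\<in>w ` {1..M}. \<not> (x < z \<and> z < x + h)"
    by (rule finite_gap_right) auto
  have pos: "\<forall>\<^sub>F h::real in at_right 0. 0 < h"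
    by (simp add: eventually_at_right_less)
  have "\<forall>\<^sub>F h in at_right 0. top_index w I (x + h) = N \<and> top_disc w I (x + h) = a N - real N * h"
    using ev gap pos
  proof eventually_elim
    case (elim h)
    have d: "disc_fun w n (x + h) = a n + - real n * h" if "n \<in> I" for n
      using disc_fun_right[OF elim(2), of n] I that elim(3) by (auto simp: a_def)
    show ?case
      using top_index_eqI[OF fin N(1), where w = w and x = "x + h"] elim(1) N(1) by (auto simp: d)
  qed
  then show ?thesis using that[of N] N by auto
qed

text \<open>Writing |y| as 1/4 plus the derivative of \<open>drift\<close> yields exactly the
  increments that \<open>pot_increment_le\<close> controls.\<close>

lemma has_integral_abs_affine:
  fixes a b A S :: real
  assumes "a \<le> b" "0 < S"
  shows "((\<lambda>x. \<bar>A - S * x\<bar>) has_integral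
    (drift (A - S * a) - drift (A - S * b)) / S + (b - a) / 4) {a..b}"
proof -
  let ?F = "\<lambda>x. - drift (A - S * x) / S + x / 4"
  have "(?F has_real_derivative \<bar>A - S * x\<bar>) (at x)" for x
  proof -
    have "((\<lambda>x. drift (A - S * x)) has_real_derivative (\<bar>A - S * x\<bar> - 1/4) * (- S)) (at x)"
      by (rule DERIV_chain'[OF _ DERIV_drift]) (auto intro!: derivative_eq_intros)
    then show ?thesis
      using assms by (auto intro!: derivative_eq_intros simp: field_simps)
  qed
  then have "((\<lambda>x. \<bar>A - S * x\<bar>) has_integral (?F b - ?F a)) {a..b}"
    using assms by (intro fundamental_theorem_of_calculus)
      (auto simp flip: has_real_derivative_iff_has_vector_derivative intro: has_field_derivative_at_within)
  moreover have "?F b - ?F a = (drift (A - S * a) - drift (A - S * b)) / S + (b - a) / 4"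
    by (simp add: diff_divide_distrib)
  ultimately show ?thesis by simp
qed

section \<open>Comparing the first and the last quarter of a block\<close>

lemma eventually_at_right_interval:
  fixes P :: "real \<Rightarrow> bool"
  assumes "\<forall>\<^sub>F h in at_right 0. P h"
  obtains d where "d > 0" "\<And>h. 0 < h \<Longrightarrow> h < d \<Longrightarrow> P h"
  using assms by (auto simp: eventually_at_right_field)

text \<open>Generic position: each jump comes from a single point, and none sits at 0 or 1. A
  perturbation reduces the general case to this one.\<close>

locale four_blocks =
  fixes w :: "nat \<Rightarrow> real" and T :: nat
  assumes T_pos: "0 < T"
    and inj: "inj_on w {1..4 * T}"
    and in_unit: "\<And>k. k \<in> {1..4 * T} \<Longrightarrow> 0 < w k \<and> w k < 1"
begin

definition gap :: "real \<Rightarrow> real" where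
  "gap x = top_disc w {3 * T..4 * T} x - top_disc w {0..T} x"

definition pos_last :: "real \<Rightarrow> real" where
  "pos_last x = real (top_index w {3 * T..4 * T} x) / real T"

definition pos_first :: "real \<Rightarrow> real" where
  "pos_first x = real (top_index w {0..T} x) / real T"

definition energy :: "real \<Rightarrow> real" where
  "energy x = potW (gap x) (pos_last x) (pos_first x)"

text \<open>A point of index k with T < k <= 3T is counted by every n >= 3T and by no n <= T, so it
  raises the gap by exactly 1.\<close>

definition cost :: "nat \<Rightarrow> real" where
  "cost k = (if T < k \<and> k \<le> 3 * T then 1/256 else 1/32)"

text \<open>Half-open, so that adjacent intervals add up and a jump at a is charged to the interval
  starting there.\<close>

definition points :: "real \<Rightarrow> real \<Rightarrow> nat set" where
  "points a b = {k \<in> {1..4 * T}. a \<le> w k \<and> w k < b}"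

definition energy_bound :: "real \<Rightarrow> real \<Rightarrow> bool" where
  "energy_bound a b \<longleftrightarrow> (\<exists>J. ((\<lambda>x. \<bar>gap x\<bar>) has_integral J) {a..b} \<and>
     energy a - energy b \<le> real T * (J - (b - a) / 4) + sum cost (points a b))"

section \<open>Energy balance, locally and on the whole unit interval\<close>

lemma scaled_last: "n \<in> {3 * T..4 * T} \<Longrightarrow> 3 \<le> real n / real T \<and> real n / real T \<le> 4"
  using T_pos by (auto simp: field_simps simp flip: of_nat_mult of_nat_le_iff)

lemma scaled_first: "m \<in> {0..T} \<Longrightarrow> 0 \<le> real m / real T \<and> real m / real T \<le> 1"
  using T_pos by (auto simp: field_simps)

lemma energy_bound_refl: "energy_bound a a"
proof -
  have "points a a = {}" by (auto simp: points_def)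
  then show ?thesis by (auto simp: energy_bound_def intro!: exI[of _ 0])
qed

lemma energy_bound_trans:
  assumes "energy_bound a b" "energy_bound b c" "a \<le> b" "b \<le> c"
  shows "energy_bound a c"
proof -
  obtain J where J: "((\<lambda>x. \<bar>gap x\<bar>) has_integral J) {a..b}"
    "energy a - energy b \<le> real T * (J - (b - a) / 4) + sum cost (points a b)"
    using assms(1) by (auto simp: energy_bound_def)
  obtain K where K: "((\<lambda>x. \<bar>gap x\<bar>) has_integral K) {b..c}"
    "energy b - energy c \<le> real T * (K - (c - b) / 4) + sum cost (points b c)"
    using assms(2) by (auto simp: energy_bound_def)
  have "points a c = points a b \<union> points b c" "points a b \<inter> points b c = {}"
    using assms(3,4) by (auto simp: points_def)
  then have "sum cost (points a c) = sum cost (points a b) + sum cost (points b c)"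
    by (simp add: sum.union_disjoint points_def)
  moreover have "((\<lambda>x. \<bar>gap x\<bar>) has_integral (J + K)) {a..c}"
    using has_integral_combine[OF assms(3,4) J(1) K(1)] .
  moreover have "real T * (J + K - (c - a) / 4)
      = real T * (J - (b - a) / 4) + real T * (K - (c - b) / 4)"
    by (simp add: field_simps)
  ultimately show ?thesis
    unfolding energy_bound_def using J(2) K(2) by (intro exI[of _ "J + K"]) auto
qed

text \<open>Here u is the right limit at the start, which a jump may separate from
  \<open>gap a\<close>; hence the affine form is assumed on the open interval only.\<close>

lemma descent:
  assumes n: "n \<in> {3 * T..4 * T}" and m: "m \<in> {0..T}" and "0 \<le> h"
    and gap_eq: "\<And>y. a < y \<Longrightarrow> y < a + h \<Longrightarrow> gap y = u - (real n - real m) * (y - a)"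
  defines "v \<equiv> u - (real n - real m) * h"
  shows "\<exists>J. ((\<lambda>x. \<bar>gap x\<bar>) has_integral J) {a..a + h} \<and>
    potW u (real n / real T) (real m / real T) - potW v (real n / real T) (real m / real T)
      \<le> real T * (J - h / 4)"
proof -
  define S where "S = real n - real m"
  define s where "s = real n / real T - real m / real T"
  have s: "2 \<le> s" "s \<le> 4"
    using scaled_last[OF n] scaled_first[OF m] unfolding s_def by linarith+
  have S: "S = s * real T" "0 < S"
    using T_pos s by (auto simp: S_def s_def field_simps)
  have "((\<lambda>x. \<bar>(u + S * a) - S * x\<bar>) has_integral
      (drift ((u + S * a) - S * a) - drift ((u + S * a) - S * (a + h))) / S + (a + h - a) / 4) {a..a + h}"
    by (rule has_integral_abs_affine) (use \<open>0 \<le> h\<close> S in auto)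
  then have "((\<lambda>x. \<bar>(u + S * a) - S * x\<bar>) has_integral (drift u - drift v) / S + h / 4) {a..a + h}"
    by (simp add: v_def S_def algebra_simps)
  then have I: "((\<lambda>x. \<bar>gap x\<bar>) has_integral (drift u - drift v) / S + h / 4) {a..a + h}"
    by (rule has_integral_spike_finite[of "{a, a + h}", rotated 2])
       (auto simp: gap_eq S_def algebra_simps)
  have "v \<le> u" using \<open>0 \<le> h\<close> S(2) by (simp add: v_def S_def)
  then have "s * (pot s u - pot s v) \<le> drift u - drift v"
    using pot_increment_le[OF s] by auto
  then have "pot s u - pot s v \<le> (drift u - drift v) / s"
    using s by (simp add: field_simps)
  also have "\<dots> = real T * ((drift u - drift v) / S + h / 4 - h / 4)"
    using T_pos S by simp
  finally show ?thesis
    using I unfolding potW_def s_def by (intro exI[of _ "(drift u - drift v) / S + h / 4"]) auto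
qed

text \<open>Left-continuity: just before x the indices are those at x, so a pure descent leads into
  x.\<close>

lemma energy_bound_left:
  "\<forall>\<^sub>F h in at_right 0. energy_bound (x - h) x"
proof -
  let ?n = "top_index w {3 * T..4 * T} x" and ?m = "top_index w {0..T} x"
  have n: "?n \<in> {3 * T..4 * T}" and m: "?m \<in> {0..T}"
    by (rule top_index_props; simp)+
  have "\<forall>\<^sub>F h in at_right 0. top_index w {3 * T..4 * T} (x - h) = ?n \<and>
     top_disc w {3 * T..4 * T} (x - h) = top_disc w {3 * T..4 * T} x + real ?n * h"
    by (rule top_disc_left[where M = "4 * T"]) auto
  moreover have "\<forall>\<^sub>F h in at_right 0. top_index w {0..T} (x - h) = ?m \<and>
     top_disc w {0..T} (x - h) = top_disc w {0..T} x + real ?m * h"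
    by (rule top_disc_left[where M = "4 * T"]) auto
  ultimately have "\<forall>\<^sub>F h in at_right 0. pos_last (x - h) = pos_last x \<and> pos_first (x - h) = pos_first x
     \<and> gap (x - h) = gap x + (real ?n - real ?m) * h"
    by eventually_elim (auto simp: pos_last_def pos_first_def gap_def algebra_simps)
  then obtain d where d: "d > 0" "\<And>h. 0 < h \<Longrightarrow> h < d \<Longrightarrow>
      pos_last (x - h) = pos_last x \<and> pos_first (x - h) = pos_first x
     \<and> gap (x - h) = gap x + (real ?n - real ?m) * h"
    by (rule eventually_at_right_interval) blast
  have "energy_bound (x - h) x" if h: "0 < h" "h < d" for h
  proof -
    have "\<exists>J. ((\<lambda>x. \<bar>gap x\<bar>) has_integral J) {x - h..x - h + h} \<and>
      potW (gap (x - h)) (real ?n / real T) (real ?m / real T)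
        - potW (gap (x - h) - (real ?n - real ?m) * h) (real ?n / real T) (real ?m / real T)
      \<le> real T * (J - h / 4)"
    proof (rule descent[OF n m])
      fix y assume "x - h < y" "y < x - h + h"
      then show "gap y = gap (x - h) - (real ?n - real ?m) * (y - (x - h))"
        using d(2)[of "x - y"] d(2)[OF h] h by (simp add: algebra_simps)
    qed (use h in simp)
    moreover have "gap (x - h) - (real ?n - real ?m) * h = gap x"
      using d(2)[OF h] by simp
    moreover have "energy (x - h) = potW (gap (x - h)) (real ?n / real T) (real ?m / real T)"
      "energy x = potW (gap x) (real ?n / real T) (real ?m / real T)"
      using d(2)[OF h] by (auto simp: energy_def pos_last_def pos_first_def)
    moreover have "0 \<le> sum cost (points (x - h) x)"
      by (intro sum_nonneg) (auto simp: cost_def)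
    ultimately show ?thesis
      unfolding energy_bound_def by fastforce
  qed
  then show ?thesis
    using d(1) by (auto simp: eventually_at_right_field)
qed

text \<open>Split by the quarter containing the index of the point at x, if there is one. A quarter
  whose functions all shift by the same constant keeps its maximisers; the other one pays for a
  partial jump.\<close>

lemma jump:
  fixes x :: real
  defines "a \<equiv> \<lambda>n. disc_fun w n x + real (card {k \<in> {1..n}. w k = x})"
  assumes n: "n \<in> {3 * T..4 * T}" "\<And>i. i \<in> {3 * T..4 * T} \<Longrightarrow> a i \<le> a n"
      "\<And>i. i \<in> {3 * T..4 * T} \<Longrightarrow> a i = a n \<Longrightarrow> n \<le> i"
    and m: "m \<in> {0..T}" "\<And>i. i \<in> {0..T} \<Longrightarrow> a i \<le> a m"
      "\<And>i. i \<in> {0..T} \<Longrightarrow> a i = a m \<Longrightarrow> m \<le> i"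
  shows "energy x \<le> sum cost {k \<in> {1..4 * T}. w k = x}
    + potW (a n - a m) (real n / real T) (real m / real T)"
proof -
  let ?L = "{3 * T..4 * T}" and ?F = "{0..T}"
  define N where "N = top_index w ?L x"
  define M where "M = top_index w ?F x"
  have N: "N \<in> ?L" "disc_fun w N x = top_disc w ?L x"
    and M: "M \<in> ?F" "disc_fun w M x = top_disc w ?F x"
    using top_index_props(1,2)[of ?L w x] top_index_props(1,2)[of ?F w x]
    by (auto simp: N_def M_def)
  have le_N: "disc_fun w i x \<le> disc_fun w N x" if "i \<in> ?L" for i
    unfolding N(2) using that by (intro disc_fun_le_top) auto
  have le_M: "disc_fun w i x \<le> disc_fun w M x" if "i \<in> ?F" for i
    unfolding M(2) using that by (intro disc_fun_le_top) auto
  have en: "energy x = potW (disc_fun w N x - disc_fun w M x) (real N / real T) (real M / real T)"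
    by (simp add: energy_def gap_def pos_last_def pos_first_def N M flip: N_def M_def)
  \<comment> \<open>N is the largest and n the smallest maximiser of the same set, so n <=
    N.\<close>
  have shift_L: "a n = disc_fun w N x + c \<and> n \<le> N"
    if "\<And>i. i \<in> ?L \<Longrightarrow> a i = disc_fun w i x + c" for c
    using that[OF n(1)] that[OF N(1)] le_N[OF n(1)] n(2)[OF N(1)] n(3)[OF N(1)] by auto
  have shift_F: "a m = disc_fun w M x + c \<and> m \<le> M"
    if "\<And>i. i \<in> ?F \<Longrightarrow> a i = disc_fun w i x + c" for c
    using that[OF m(1)] that[OF M(1)] le_M[OF m(1)] m(2)[OF M(1)] m(3)[OF M(1)] by auto
  note sc = scaled_last[OF n(1)] scaled_last[OF N(1)] scaled_first[OF m(1)] scaled_first[OF M(1)]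
  have mono: "i \<le> j \<Longrightarrow> real i / real T \<le> real j / real T" for i j
    by (simp add: divide_right_mono)
  show ?thesis
  proof (cases "\<exists>k\<in>{1..4 * T}. w k = x")
    case False
    then have a: "a i = disc_fun w i x + 0" if "i \<le> 4 * T" for i
      using that by (force simp: a_def card_eq_0_iff)
    have "a n = disc_fun w N x + 0 \<and> n \<le> N" by (rule shift_L, rule a) simp
    moreover have "a m = disc_fun w M x + 0 \<and> m \<le> M" by (rule shift_F, rule a) simp
    moreover have none: "{k \<in> {1..4 * T}. w k = x} = {}" using False by auto
    ultimately show ?thesis
      unfolding en none using potW_antimono mono by auto
  next
    case True
    then obtain k where k: "k \<in> {1..4 * T}" "w k = x" by auto
    have single: "{i \<in> {1..j}. w i = x} = (if k \<le> j then {k} else {})" if "j \<le> 4 * T" for j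
    proof -
      have "i = k" if "i \<in> {1..j}" "w i = x" for i
        using inj_onD[OF inj, of i k] k that \<open>j \<le> 4 * T\<close> by simp
      then show ?thesis using k by auto
    qed
    have a: "a i = disc_fun w i x + (if k \<le> i then 1 else 0)" if "i \<le> 4 * T" for i
      using single[OF that] by (simp add: a_def)
    have cost: "sum cost {k \<in> {1..4 * T}. w k = x} = cost k"
      using single[of "4 * T"] k by simp
    consider "k \<le> T" | "T < k" "k \<le> 3 * T" | "3 * T < k" by linarith
    then show ?thesis
    proof cases
      case 1
      have L: "a n = disc_fun w N x + 1 \<and> n \<le> N" by (rule shift_L) (use 1 in \<open>auto simp: a\<close>)
      \<comment> \<open>The first quarter's maximum gains at most the 1 gained by the last one's, so
        the gap does not fall.\<close>
      have "a m \<le> disc_fun w M x + 1"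
        using le_M[OF m(1)] m(1) by (auto simp: a)
      then have "potW (disc_fun w N x - disc_fun w M x) (real N / real T) (real M / real T)
        \<le> 1/32 + potW (a n - a m) (real N / real T) (real m / real T)"
        using sc L by (intro potW_partial_jump_first) auto
      also have "\<dots> \<le> 1/32 + potW (a n - a m) (real n / real T) (real m / real T)"
        using L mono by (intro add_left_mono potW_antimono) auto
      finally show ?thesis
        using 1 cost by (simp add: en cost_def)
    next
      case 2
      have L: "a n = disc_fun w N x + 1 \<and> n \<le> N" by (rule shift_L) (use 2 in \<open>auto simp: a\<close>)
      have F: "a m = disc_fun w M x + 0 \<and> m \<le> M" by (rule shift_F) (use 2 in \<open>auto simp: a\<close>)
      have "potW (disc_fun w N x - disc_fun w M x) (real N / real T) (real M / real T)
        \<le> 1/256 + potW (disc_fun w N x - disc_fun w M x + 1) (real N / real T) (real M / real T)"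
        using sc by (intro potW_unit_jump) auto
      also have "\<dots> \<le> 1/256 + potW (disc_fun w N x - disc_fun w M x + 1) (real n / real T) (real m / real T)"
        using L F mono by (intro add_left_mono potW_antimono) auto
      also have "disc_fun w N x - disc_fun w M x + 1 = a n - a m" using L F by simp
      finally show ?thesis
        using 2 cost by (simp add: en cost_def)
    next
      case 3
      have F: "a m = disc_fun w M x + 0 \<and> m \<le> M" by (rule shift_F) (use 3 in \<open>auto simp: a\<close>)
      have "disc_fun w N x \<le> a n"
        using n(2)[OF N(1)] N(1) by (auto simp: a split: if_splits)
      then have "potW (disc_fun w N x - disc_fun w M x) (real N / real T) (real M / real T)
        \<le> 1/32 + potW (a n - a m) (real n / real T) (real M / real T)"
        using sc F by (intro potW_partial_jump_last) auto
      also have "\<dots> \<le> 1/32 + potW (a n - a m) (real n / real T) (real m / real T)"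
        using F mono by (intro add_left_mono potW_antimono) auto
      finally show ?thesis
        using 3 cost by (simp add: en cost_def)
    qed
  qed
qed

text \<open>First the jump at x, paid by the points at x, then a descent.\<close>

lemma energy_bound_right:
  "\<forall>\<^sub>F h in at_right 0. energy_bound x (x + h)"
proof -
  let ?a = "\<lambda>n. disc_fun w n x + real (card {k \<in> {1..n}. w k = x})"
  obtain n where n: "n \<in> {3 * T..4 * T}" "\<And>i. i \<in> {3 * T..4 * T} \<Longrightarrow> ?a i \<le> ?a n"
      "\<And>i. i \<in> {3 * T..4 * T} \<Longrightarrow> ?a i = ?a n \<Longrightarrow> n \<le> i"
    and evn: "\<forall>\<^sub>F h in at_right 0. top_index w {3 * T..4 * T} (x + h) = n \<and>
        top_disc w {3 * T..4 * T} (x + h) = ?a n - real n * h"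
    by (rule top_disc_right[of "{3 * T..4 * T}" "4 * T" w x]) auto
  obtain m where m: "m \<in> {0..T}" "\<And>i. i \<in> {0..T} \<Longrightarrow> ?a i \<le> ?a m"
      "\<And>i. i \<in> {0..T} \<Longrightarrow> ?a i = ?a m \<Longrightarrow> m \<le> i"
    and evm: "\<forall>\<^sub>F h in at_right 0. top_index w {0..T} (x + h) = m \<and>
        top_disc w {0..T} (x + h) = ?a m - real m * h"
    by (rule top_disc_right[of "{0..T}" "4 * T" w x]) auto
  define u where "u = ?a n - ?a m"
  have "\<forall>\<^sub>F h in at_right 0. pos_last (x + h) = real n / real T \<and> pos_first (x + h) = real m / real T
     \<and> gap (x + h) = u - (real n - real m) * h"
    using evn evm
    by eventually_elim (auto simp: pos_last_def pos_first_def gap_def u_def algebra_simps)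
  then obtain d where d: "d > 0" "\<And>h. 0 < h \<Longrightarrow> h < d \<Longrightarrow>
      pos_last (x + h) = real n / real T \<and> pos_first (x + h) = real m / real T
     \<and> gap (x + h) = u - (real n - real m) * h"
    by (rule eventually_at_right_interval) blast
  have jump: "energy x \<le> sum cost {k \<in> {1..4 * T}. w k = x} + potW u (real n / real T) (real m / real T)"
    unfolding u_def by (rule jump) (fact n m)+
  have "energy_bound x (x + h)" if h: "0 < h" "h < d" for h
  proof -
    have "\<exists>J. ((\<lambda>x. \<bar>gap x\<bar>) has_integral J) {x..x + h} \<and>
      potW u (real n / real T) (real m / real T)
        - potW (u - (real n - real m) * h) (real n / real T) (real m / real T)
      \<le> real T * (J - h / 4)"
    proof (rule descent[OF n(1) m(1)])
      fix y assume "x < y" "y < x + h"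
      then show "gap y = u - (real n - real m) * (y - x)"
        using d(2)[of "y - x"] h by simp
    qed (use h in simp)
    then obtain J where J: "((\<lambda>x. \<bar>gap x\<bar>) has_integral J) {x..x + h}"
      "potW u (real n / real T) (real m / real T)
        - potW (u - (real n - real m) * h) (real n / real T) (real m / real T)
      \<le> real T * (J - h / 4)" by blast
    have "energy (x + h) = potW (u - (real n - real m) * h) (real n / real T) (real m / real T)"
      using d(2)[OF h] by (simp add: energy_def)
    moreover have "sum cost {k \<in> {1..4 * T}. w k = x} \<le> sum cost (points x (x + h))"
      using h by (intro sum_mono2) (auto simp: cost_def points_def)
    ultimately show ?thesis
      unfolding energy_bound_def using J jump by (intro exI[of _ J]) auto
  qed
  then show ?thesis
    using d(1) by (auto simp: eventually_at_right_field)
qed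

text \<open>Additivity and validity on both sides of every point give the global bound by bisection,
  without listing breakpoints.\<close>

lemma energy_bound_unit: "energy_bound 0 1"
proof (rule Bolzano[of 0 1 energy_bound])
  show "(0::real) \<le> 1" by simp
  show "energy_bound a c" if "energy_bound a b" "energy_bound b c" "a \<le> b" "b \<le> c" for a b c
    using energy_bound_trans that .
  fix x :: real
  obtain d1 where d1: "d1 > 0" "\<And>h. 0 < h \<Longrightarrow> h < d1 \<Longrightarrow> energy_bound (x - h) x"
    by (rule eventually_at_right_interval[OF energy_bound_left]) blast
  obtain d2 where d2: "d2 > 0" "\<And>h. 0 < h \<Longrightarrow> h < d2 \<Longrightarrow> energy_bound x (x + h)"
    by (rule eventually_at_right_interval[OF energy_bound_right]) blast
  have "energy_bound a b" if "a \<le> x" "x \<le> b" "b - a < min d1 d2" for a b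
  proof (rule energy_bound_trans[of a x b])
    show "energy_bound a x"
      using d1(2)[of "x - a"] that energy_bound_refl by (cases "a = x") auto
    show "energy_bound x b"
      using d2(2)[of "b - x"] that energy_bound_refl by (cases "b = x") auto
  qed (use that in auto)
  then show "\<exists>d>0. \<forall>a b. a \<le> x \<and> x \<le> b \<and> b - a < d \<longrightarrow> energy_bound a b"
    using d1(1) d2(1) by (intro exI[of _ "min d1 d2"]) auto
qed

lemma integral_abs_gap:
  "\<exists>J \<ge> 23/128. ((\<lambda>x. \<bar>gap x\<bar>) has_integral J) {0..1}"
proof -
  obtain J where J: "((\<lambda>x. \<bar>gap x\<bar>) has_integral J) {0..1}"
    "energy 0 - energy 1 \<le> real T * (J - 1 / 4) + sum cost (points 0 1)"
    using energy_bound_unit by (auto simp: energy_bound_def)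
  \<comment> \<open>Both values are 0, as all points lie strictly between 0 and 1; hence the energy
    returns to its initial value.\<close>
  have *: "disc_fun w n 0 = disc_fun w n 1" if "n \<le> 4 * T" for n
  proof -
    have "{k \<in> {1..n}. w k < 0} = {}" "{k \<in> {1..n}. w k < 1} = {1..n}"
      using in_unit that by force+
    then show ?thesis by (simp add: disc_fun_def count_below_def)
  qed
  have "top_disc w I 0 = top_disc w I 1 \<and> top_index w I 0 = top_index w I 1" if "I \<subseteq> {..4 * T}" for I
  proof -
    have eq: "disc_fun w n 0 = disc_fun w n 1" if "n \<in> I" for n
      using * that \<open>I \<subseteq> {..4 * T}\<close> by auto
    then have "top_disc w I 0 = top_disc w I 1" by (simp add: top_disc_def cong: image_cong)
    then show ?thesis using eq by (auto simp: top_index_def cong: conj_cong)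
  qed
  from this[of "{3 * T..4 * T}"] this[of "{0..T}"] have "energy 0 = energy 1"
    by (auto simp: energy_def gap_def pos_last_def pos_first_def)
  moreover have "points 0 1 = {1..4 * T}"
    using in_unit by (force simp: points_def)
  \<comment> \<open>2T points at 1/32 and 2T points at 1/256; then 1/4 - 9/128 = 23/128.\<close>
  moreover have "sum cost {1..4 * T} = real T * (9/128)"
  proof -
    have "{1..4 * T} = ({1..T} \<union> {T + 1..3 * T}) \<union> {3 * T + 1..4 * T}" by auto
    also have "sum cost \<dots> = sum cost ({1..T} \<union> {T + 1..3 * T}) + sum cost {3 * T + 1..4 * T}"
      by (rule sum.union_disjoint) auto
    also have "sum cost ({1..T} \<union> {T + 1..3 * T}) = sum cost {1..T} + sum cost {T + 1..3 * T}"
      by (rule sum.union_disjoint) auto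
    finally have "sum cost {1..4 * T} = sum cost {1..T} + sum cost {T + 1..3 * T} + sum cost {3 * T + 1..4 * T}" .
    also have "\<dots> = (\<Sum>k\<in>{1..T}. 1/32) + (\<Sum>k\<in>{T + 1..3 * T}. 1/256) + (\<Sum>k\<in>{3 * T + 1..4 * T}. 1/32)"
      by (intro arg_cong2[where f = "(+)"] sum.cong) (auto simp: cost_def)
    also have "\<dots> = real T * (9/128)" by simp
    finally show ?thesis .
  qed
  ultimately have "0 \<le> real T * (J - 23/128)" using J(2) by (simp add: algebra_simps)
  then have "23/128 \<le> J" using T_pos by (simp add: zero_le_mult_iff)
  then show ?thesis using J(1) by blast
qed

end

section \<open>Growth of the discrepancy\<close>

definition bot_disc :: "(nat \<Rightarrow> real) \<Rightarrow> nat set \<Rightarrow> real \<Rightarrow> real" where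
  "bot_disc w I x = Min ((\<lambda>n. disc_fun w n x) ` I)"

definition spread :: "(nat \<Rightarrow> real) \<Rightarrow> nat \<Rightarrow> real \<Rightarrow> real" where
  "spread w T x = top_disc w {0..T} x - bot_disc w {0..T} x"

definition generic :: "(nat \<Rightarrow> real) \<Rightarrow> nat \<Rightarrow> bool" where
  "generic w N \<longleftrightarrow> inj_on w {1..N} \<and> (\<forall>k\<in>{1..N}. 0 < w k \<and> w k < 1)"

lemma genericD:
  assumes "generic w N"
  shows "inj_on w {1..N}" "\<And>k. k \<in> {1..N} \<Longrightarrow> 0 < w k \<and> w k < 1"
  using assms by (simp_all add: generic_def)

lemma genericI:
  assumes "\<And>i j. i \<in> {1..N} \<Longrightarrow> j \<in> {1..N} \<Longrightarrow> w i = w j \<Longrightarrow> i = j"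
    and "\<And>k. k \<in> {1..N} \<Longrightarrow> 0 < w k \<and> w k < 1"
  shows "generic w N"
  unfolding generic_def by (rule conjI[OF inj_onI ballI]; rule assms; assumption)

lemma generic_reflect:
  assumes "generic w N"
  shows "generic (\<lambda>k. 1 - w k) N"
proof (rule genericI)
  fix i j assume "i \<in> {1..N}" "j \<in> {1..N}" "1 - w i = 1 - w j"
  then show "i = j"
    by (intro inj_onD[OF genericD(1)[OF assms]]) simp_all
next
  fix k assume "k \<in> {1..N}"
  then show "0 < 1 - w k \<and> 1 - w k < 1"
    using genericD(2)[OF assms] by simp
qed

text \<open>K = 0 gives the first quarter, K = 3T the last one.\<close>

lemma generic_shift:
  assumes "generic w N" "M + K \<le> N"
  shows "generic (\<lambda>k. w (K + k)) M"
proof (rule genericI)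
  fix i j assume "i \<in> {1..M}" "j \<in> {1..M}" "w (K + i) = w (K + j)"
  then have "K + i = K + j"
    using assms(2) by (intro inj_onD[OF genericD(1)[OF assms(1)]]) simp_all
  then show "i = j" by simp
next
  fix k assume "k \<in> {1..M}"
  then show "0 < w (K + k) \<and> w (K + k) < 1"
    using assms(2) by (intro genericD(2)[OF assms(1)]) simp
qed

section \<open>Translation and reflection of the sequence\<close>

lemma disc_fun_shift: "disc_fun w (K + n) x = disc_fun w K x + disc_fun (\<lambda>k. w (K + k)) n x"
proof -
  have "{k \<in> {1..K + n}. w k < x} = {k \<in> {1..K}. w k < x} \<union> (+) K ` {k \<in> {1..n}. w (K + k) < x}"
    (is "?A = ?B \<union> ?C")
  proof (intro equalityI subsetI)
    fix k assume "k \<in> ?A"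
    then have k: "1 \<le> k" "k \<le> K + n" "w k < x" by simp_all
    show "k \<in> ?B \<union> ?C"
    proof (cases "k \<le> K")
      case True
      then show ?thesis using k by simp
    next
      case False
      then have "k - K \<in> {k \<in> {1..n}. w (K + k) < x}" "k = K + (k - K)"
        using k by auto
      then show ?thesis by (metis (no_types, lifting) UnI2 image_eqI)
    qed
  next
    fix k assume "k \<in> ?B \<union> ?C"
    then show "k \<in> ?A" by auto
  qed
  moreover have "card (?B \<union> ?C) = card ?B + card ?C"
    by (intro card_Un_disjoint) auto
  moreover have "card ?C = card {k \<in> {1..n}. w (K + k) < x}"
    by (intro card_image) auto
  ultimately have "count_below w (K + n) x = count_below w K x + count_below (\<lambda>k. w (K + k)) n x"
    by (simp only: count_below_def)
  then show ?thesis
    by (simp add: disc_fun_def algebra_simps)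
qed

text \<open>The offset is independent of n and cancels in the spread, which reduces the last quarter
  to an initial block.\<close>

lemma top_disc_shift:
  "top_disc w {K..K + T} x = disc_fun w K x + top_disc (\<lambda>k. w (K + k)) {0..T} x"
proof -
  have "(\<lambda>n. disc_fun w n x) ` {K..K + T} = (\<lambda>n. disc_fun w n x) ` (+) K ` {0..T}"
    by (simp add: add.commute)
  also have "\<dots> = (+) (disc_fun w K x) ` (\<lambda>n. disc_fun (\<lambda>k. w (K + k)) n x) ` {0..T}"
    by (simp only: image_image disc_fun_shift)
  finally show ?thesis
    unfolding top_disc_def
    by (simp only:) (rule mono_Max_commute[symmetric]; simp add: mono_def)
qed

lemma bot_disc_shift:
  "bot_disc w {K..K + T} x = disc_fun w K x + bot_disc (\<lambda>k. w (K + k)) {0..T} x"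
proof -
  have "(\<lambda>n. disc_fun w n x) ` {K..K + T} = (\<lambda>n. disc_fun w n x) ` (+) K ` {0..T}"
    by (simp add: add.commute)
  also have "\<dots> = (+) (disc_fun w K x) ` (\<lambda>n. disc_fun (\<lambda>k. w (K + k)) n x) ` {0..T}"
    by (simp only: image_image disc_fun_shift)
  finally show ?thesis
    unfolding bot_disc_def
    by (simp only:) (rule mono_Min_commute[symmetric]; simp add: mono_def)
qed

text \<open>At a point of the sequence both strict inequalities fail, so these finitely many x are
  excluded.\<close>

lemma disc_fun_reflect:
  assumes "x \<notin> w ` {1..n}"
  shows "disc_fun (\<lambda>k. 1 - w k) n (1 - x) = - disc_fun w n x"
proof -
  have "{1..n} = {k \<in> {1..n}. w k < x} \<union> {k \<in> {1..n}. 1 - w k < 1 - x}" (is "_ = ?A \<union> ?B")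
  proof -
    have "w k < x \<or> 1 - w k < 1 - x" if "k \<in> {1..n}" for k
    proof -
      have "w k \<noteq> x" using assms that by blast
      then show ?thesis by linarith
    qed
    then show ?thesis by blast
  qed
  moreover have "card (?A \<union> ?B) = card ?A + card ?B"
    by (intro card_Un_disjoint) auto
  ultimately have "card {1..n} = card ?A + card ?B" by (simp only:)
  then have "real n = real (card ?A) + real (card ?B)" by simp
  then show ?thesis by (simp add: disc_fun_def count_below_def algebra_simps)
qed

lemma bot_disc_reflect:
  assumes "x \<notin> w ` {1..N}" "I \<subseteq> {..N}" "I \<noteq> {}"
  shows "bot_disc w I x = - top_disc (\<lambda>k. 1 - w k) I (1 - x)"
proof -
  have fin: "finite I" using assms finite_subset by blast
  have "disc_fun (\<lambda>k. 1 - w k) n (1 - x) = - disc_fun w n x" if "n \<in> I" for n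
  proof (rule disc_fun_reflect)
    have "{1..n} \<subseteq> {1..N}" using that assms(2) by auto
    then show "x \<notin> w ` {1..n}" using assms(1) by blast
  qed
  then have "(\<lambda>n. disc_fun (\<lambda>k. 1 - w k) n (1 - x)) ` I = uminus ` (\<lambda>n. disc_fun w n x) ` I"
    by (auto simp: image_image)
  then show ?thesis
    unfolding bot_disc_def top_disc_def
    using fin assms(3) by (simp flip: minus_Min_eq_Max)
qed

lemma integral_abs_top_disc_diff:
  assumes "generic w (4 * T)" "0 < T"
  obtains J where "J \<ge> 23/128"
    "((\<lambda>x. \<bar>top_disc w {3 * T..4 * T} x - top_disc w {0..T} x\<bar>) has_integral J) {0..1}"
proof -
  interpret four_blocks w T
    using assms(2) genericD[OF assms(1)] by unfold_locales
  show ?thesis using integral_abs_gap that by (auto simp: gap_def)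
qed

text \<open>Reflection exchanges minima and maxima off a finite set; the substitution x -> 1 - x
  preserves the integral.\<close>

lemma integral_abs_bot_disc_diff:
  assumes "generic w (4 * T)" "0 < T"
  obtains J where "J \<ge> 23/128"
    "((\<lambda>x. \<bar>bot_disc w {3 * T..4 * T} x - bot_disc w {0..T} x\<bar>) has_integral J) {0..1}"
proof -
  let ?v = "\<lambda>k. 1 - w k"
  obtain J where J: "J \<ge> 23/128"
    "((\<lambda>x. \<bar>top_disc ?v {3 * T..4 * T} x - top_disc ?v {0..T} x\<bar>) has_integral J) {0..1}"
    using integral_abs_top_disc_diff[OF generic_reflect[OF assms(1)] assms(2)] by blast
  have "((\<lambda>x. \<bar>top_disc ?v {3 * T..4 * T} (1 - x) - top_disc ?v {0..T} (1 - x)\<bar>) has_integral J) {0..1}"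
    using has_integral_affinity[of "\<lambda>x. \<bar>top_disc ?v {3 * T..4 * T} x - top_disc ?v {0..T} x\<bar>" J 0 1 "- 1" 1] J(2)
    by (simp add: image_affinity_atLeastAtMost)
  then have "((\<lambda>x. \<bar>bot_disc w {3 * T..4 * T} x - bot_disc w {0..T} x\<bar>) has_integral J) {0..1}"
  proof (rule has_integral_spike_finite[of "w ` {1..4 * T}", rotated 2])
    fix x assume "x \<in> {0..1} - w ` {1..4 * T}"
    then have x: "x \<notin> w ` {1..4 * T}" by simp
    have "bot_disc w {3 * T..4 * T} x = - top_disc ?v {3 * T..4 * T} (1 - x)"
      "bot_disc w {0..T} x = - top_disc ?v {0..T} (1 - x)"
      by (rule bot_disc_reflect[OF x]; auto)+
    then show "\<bar>bot_disc w {3 * T..4 * T} x - bot_disc w {0..T} x\<bar>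
      = \<bar>top_disc ?v {3 * T..4 * T} (1 - x) - top_disc ?v {0..T} (1 - x)\<bar>" by simp
  qed auto
  then show ?thesis using that J(1) by blast
qed

section \<open>Integrability of the spread and the recursion\<close>

lemma abs_disc_fun_le:
  assumes "x \<in> {0..1}"
  shows "\<bar>disc_fun w n x\<bar> \<le> real n"
proof -
  have "card {k \<in> {1..n}. w k < x} \<le> card {1..n}" by (intro card_mono) auto
  moreover have "real n * x \<le> real n" "0 \<le> real n * x"
    using assms by (auto simp: mult_left_le)
  ultimately show ?thesis by (auto simp: disc_fun_def count_below_def abs_le_iff)
qed

lemma top_disc_attained:
  assumes "finite I" "I \<noteq> {}"
  shows "\<exists>n\<in>I. top_disc w I x = disc_fun w n x"
  using top_index_props(1,2)[OF assms, of w x] by metis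

lemma bot_disc_attained:
  assumes "finite I" "I \<noteq> {}"
  shows "\<exists>n\<in>I. bot_disc w I x = disc_fun w n x"
proof -
  have "bot_disc w I x \<in> (\<lambda>n. disc_fun w n x) ` I"
    unfolding bot_disc_def using assms by (intro Min_in) auto
  then show ?thesis by auto
qed

lemma borel_measurable_disc_fun: "disc_fun w n \<in> borel_measurable borel"
proof -
  have "disc_fun w n = (\<lambda>x. (\<Sum>k\<in>{1..n}. indicator {w k<..} x) - real n * x)"
    by (auto simp: fun_eq_iff disc_fun_def count_below_def indicator_def sum.If_cases Int_def)
  then show ?thesis by simp
qed

lemma spread_integrable: "spread w T integrable_on {0..1}"
proof (rule measurable_bounded_by_integrable_imp_integrable)
  have "(\<lambda>x. Max ((\<lambda>n. disc_fun w n x) ` {0..T})) \<in> borel_measurable borel"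
    "(\<lambda>x. Min ((\<lambda>n. disc_fun w n x) ` {0..T})) \<in> borel_measurable borel"
    by (rule borel_measurable_Max borel_measurable_Min; simp add: borel_measurable_disc_fun)+
  then have "spread w T \<in> borel_measurable borel"
    unfolding spread_def[abs_def] top_disc_def bot_disc_def by (rule borel_measurable_diff)
  then show "spread w T \<in> borel_measurable (lebesgue_on {0..1})"
    by (simp add: borel_measurable_if_D measurable_completion measurable_restrict_space1)
  show "(\<lambda>_. 2 * real T) integrable_on {0..1::real}" by (rule integrable_const_ivl)
  fix x :: real assume x: "x \<in> {0..1}"
  obtain n m where "n \<in> {0..T}" "top_disc w {0..T} x = disc_fun w n x"
    "m \<in> {0..T}" "bot_disc w {0..T} x = disc_fun w m x"
    using top_disc_attained[of "{0..T}" w x] bot_disc_attained[of "{0..T}" w x] by auto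
  then show "norm (spread w T x) \<le> 2 * real T"
    using abs_disc_fun_le[OF x, of w n] abs_disc_fun_le[OF x, of w m]
    by (auto simp: spread_def abs_le_iff)
qed auto

text \<open>|p - q| = 2 max(p, q) - p - q, and the maximum over the whole block dominates both;
  dually for the minima.\<close>

lemma spread_four_blocks:
  "spread w T x + spread (\<lambda>k. w (3 * T + k)) T x
    + \<bar>top_disc w {3 * T..4 * T} x - top_disc w {0..T} x\<bar>
    + \<bar>bot_disc w {3 * T..4 * T} x - bot_disc w {0..T} x\<bar> \<le> 2 * spread w (4 * T) x"
proof -
  have "top_disc w {0..T} x \<le> top_disc w {0..4 * T} x" "top_disc w {3 * T..4 * T} x \<le> top_disc w {0..4 * T} x"
    unfolding top_disc_def by (rule Max_mono; auto)+
  then have "\<bar>top_disc w {3 * T..4 * T} x - top_disc w {0..T} x\<bar>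
      \<le> 2 * top_disc w {0..4 * T} x - top_disc w {3 * T..4 * T} x - top_disc w {0..T} x"
    by linarith
  moreover have "bot_disc w {0..4 * T} x \<le> bot_disc w {0..T} x" "bot_disc w {0..4 * T} x \<le> bot_disc w {3 * T..4 * T} x"
    unfolding bot_disc_def by (rule Min_antimono; auto)+
  then have "\<bar>bot_disc w {3 * T..4 * T} x - bot_disc w {0..T} x\<bar>
      \<le> bot_disc w {3 * T..4 * T} x + bot_disc w {0..T} x - 2 * bot_disc w {0..4 * T} x"
    by linarith
  moreover have "spread (\<lambda>k. w (3 * T + k)) T x = top_disc w {3 * T..4 * T} x - bot_disc w {3 * T..4 * T} x"
    using top_disc_shift[of w "3 * T" T x] bot_disc_shift[of w "3 * T" T x] by (simp add: spread_def)
  ultimately show ?thesis by (simp add: spread_def)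
qed

text \<open>Each quadrupling adds (J + K)/2 >= 23/128 to the average over two quarters. The
  induction ranges over all sequences because the last quarter belongs to a shifted one.\<close>

lemma integral_spread_ge:
  assumes "generic w (4 ^ t)"
  shows "23/128 * real t \<le> integral {0..1} (spread w (4 ^ t))"
  using assms
proof (induction t arbitrary: w)
  case 0
  have "0 \<le> spread w 1 x" for x
    unfolding spread_def top_disc_def bot_disc_def by (auto simp: Min_le_iff intro!: Max_ge)
  then show ?case by (simp add: integral_nonneg spread_integrable)
next
  case (Suc t)
  define T where "T = (4::nat) ^ t"
  let ?v = "\<lambda>k. w (3 * T + k)"
  have gen: "generic w (4 * T)" and T: "0 < T" using Suc.prems by (auto simp: T_def)
  obtain J where J: "J \<ge> 23/128"
    "((\<lambda>x. \<bar>top_disc w {3 * T..4 * T} x - top_disc w {0..T} x\<bar>) has_integral J) {0..1}"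
    using integral_abs_top_disc_diff[OF gen T] .
  obtain K where K: "K \<ge> 23/128"
    "((\<lambda>x. \<bar>bot_disc w {3 * T..4 * T} x - bot_disc w {0..T} x\<bar>) has_integral K) {0..1}"
    using integral_abs_bot_disc_diff[OF gen T] .
  note sp = integrable_integral[OF spread_integrable]
  have "integral {0..1} (spread w T) + integral {0..1} (spread ?v T) + J + K
      \<le> 2 * integral {0..1} (spread w (4 * T))"
    by (rule has_integral_le[OF has_integral_add[OF has_integral_add[OF has_integral_add[OF sp sp] J(2)] K(2)]
          has_integral_mult_right[OF sp]]) (rule spread_four_blocks)
  moreover have "23/128 * real t \<le> integral {0..1} (spread w T)"
    using Suc.IH[of w] generic_shift[OF gen, of T 0] by (simp add: T_def)
  moreover have "23/128 * real t \<le> integral {0..1} (spread ?v T)"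
    using Suc.IH[of ?v] generic_shift[OF gen, of T "3 * T"] by (simp add: T_def)
  ultimately show ?case
    using J(1) K(1) by (simp add: T_def algebra_simps)
qed

lemma oscillation_ge:
  assumes "generic w (4 ^ t)"
    and "\<And>n x. n \<le> 4 ^ t \<Longrightarrow> x \<in> {0..1} \<Longrightarrow> L \<le> disc_fun w n x \<and> disc_fun w n x \<le> B"
  shows "23/128 * real t \<le> B - L"
proof -
  have "spread w (4 ^ t) x \<le> B - L" if x: "x \<in> {0..1}" for x
  proof -
    obtain n m where "n \<in> {0..4 ^ t}" "top_disc w {0..4 ^ t} x = disc_fun w n x"
      "m \<in> {0..4 ^ t}" "bot_disc w {0..4 ^ t} x = disc_fun w m x"
      using top_disc_attained[of "{0..4 ^ t}" w x] bot_disc_attained[of "{0..4 ^ t}" w x] by auto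
    then show ?thesis
      using assms(2)[of n x] assms(2)[of m x] x by (auto simp: spread_def)
  qed
  then have "integral {0..1} (spread w (4 ^ t)) \<le> integral {0..1::real} (\<lambda>_. B - L)"
    by (intro integral_le spread_integrable) auto
  then show ?thesis using integral_spread_ge[OF assms(1)] by simp
qed

section \<open>Perturbing an arbitrary sequence into generic position\<close>

lemma eventually_generic_perturbation:
  assumes "w \<in> unit_seqs"
  shows "\<forall>\<^sub>F e in at_right 0. generic (\<lambda>k. w k + e * real k) N"
proof -
  have pos: "\<forall>\<^sub>F e::real in at_right 0. 0 < e"
    by (simp add: eventually_at_right_less)
  have "\<forall>\<^sub>F e in at_right 0. \<forall>k\<in>{1..N}. w k + e * real k < 1"
  proof (intro eventually_ball_finite ballI)
    fix k assume "k \<in> {1..N}"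
    then have "w k < 1" using assms by (auto simp: unit_seqs_def)
    moreover have "((\<lambda>e. w k + e * real k) \<longlongrightarrow> w k) (at_right 0)"
      by (auto intro!: tendsto_eq_intros)
    ultimately show "\<forall>\<^sub>F e in at_right 0. w k + e * real k < 1"
      by (intro order_tendstoD(2))
  qed auto
  moreover have "\<forall>\<^sub>F e in at_right 0. \<forall>i\<in>{1..N}. \<forall>j\<in>{1..N}. i \<noteq> j \<longrightarrow> w i + e * real i \<noteq> w j + e * real j"
  proof (intro eventually_ball_finite ballI)
    fix i j :: nat
    show "\<forall>\<^sub>F e in at_right 0. i \<noteq> j \<longrightarrow> w i + e * real i \<noteq> w j + e * real j"
    proof (cases "i = j")
      case False
      \<comment> \<open>The only e at which the points i and j collide.\<close>
      define r where "r = (w j - w i) / (real i - real j)"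
      have "\<forall>\<^sub>F e in at_right 0. e \<noteq> r"
        using eventually_neq_at_within[of r 0 "{0<..}"] by simp
      then show ?thesis
      proof eventually_elim
        case (elim e)
        show ?case
        proof (intro impI notI)
          assume "w i + e * real i = w j + e * real j"
          then have "e * (real i - real j) = w j - w i" by (simp add: algebra_simps)
          then show False using elim False by (simp add: r_def field_simps)
        qed
      qed
    qed auto
  qed auto
  ultimately show ?thesis
    using pos
  proof eventually_elim
    case (elim e)
    have "0 < w k + e * real k" if "k \<in> {1..N}" for k
      using assms that elim(3) by (intro add_nonneg_pos) (auto simp: unit_seqs_def)
    with elim(1,2) show ?case by (intro genericI) blast+
  qed
qed

lemma abs_local_discrepancy_le_1:
  assumes "x \<in> {0..1}"
  shows "\<bar>real (count_below w N x) / real N - x\<bar> \<le> 1"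
proof -
  have "card {k \<in> {1..N}. w k < x} \<le> card {1..N}" by (intro card_mono) auto
  then have "real (count_below w N x) / real N \<le> 1"
    by (cases "N = 0") (auto simp: count_below_def)
  moreover have "0 \<le> real (count_below w N x) / real N" by simp
  ultimately show ?thesis
    using assms unfolding abs_le_iff atLeastAtMost_iff by linarith
qed

lemma star_discrepancy_le_1: "star_discrepancy w N \<le> 1"
  unfolding star_discrepancy_def by (rule cSUP_least) (auto intro: abs_local_discrepancy_le_1)

lemma abs_disc_fun_le_star:
  assumes "x \<in> {0..1}"
  shows "\<bar>disc_fun w n x\<bar> \<le> real n * star_discrepancy w n"
proof (cases "n = 0")
  case True
  then show ?thesis by (simp add: disc_fun_def count_below_def)
next
  case False
  have "disc_fun w n x = real n * (real (count_below w n x) / real n - x)"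
    using False by (simp add: disc_fun_def field_simps)
  then have "\<bar>disc_fun w n x\<bar> = real n * \<bar>real (count_below w n x) / real n - x\<bar>"
    by (simp add: abs_mult)
  also have "\<dots> \<le> real n * star_discrepancy w n"
    unfolding star_discrepancy_def
    by (intro mult_left_mono cSUP_upper assms bdd_aboveI2[where M = 1] abs_local_discrepancy_le_1) auto
  finally show ?thesis .
qed

text \<open>Points move right by at most d = eN, so the new count at x lies between the old counts
  at x - d and at x.\<close>

lemma disc_fun_perturb:
  assumes e: "0 < e" and n: "n \<le> N" and x: "x \<in> {0..1}"
    and B: "\<And>y. y \<in> {0..1} \<Longrightarrow> \<bar>disc_fun w n y\<bar> \<le> B"
  shows "- B - e * (real N)\<^sup>2 \<le> disc_fun (\<lambda>k. w k + e * real k) n x"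
    "disc_fun (\<lambda>k. w k + e * real k) n x \<le> B"
proof -
  let ?v = "\<lambda>k. w k + e * real k"
  have "count_below ?v n x \<le> count_below w n x"
    unfolding count_below_def
  proof (intro card_mono subsetI CollectI)
    fix k assume "k \<in> {k \<in> {1..n}. ?v k < x}"
    moreover have "0 \<le> e * real k" using e by simp
    ultimately show "k \<in> {1..n} \<and> w k < x" by (auto simp del: mult_nonneg_nonneg)
  qed auto
  then have "disc_fun ?v n x \<le> disc_fun w n x" by (simp add: disc_fun_def)
  then show "disc_fun ?v n x \<le> B" using B[OF x] by (simp add: abs_le_iff)
  define d where "d = e * real N"
  have nd: "real n * d \<le> e * (real N)\<^sup>2"
    using n e by (simp add: d_def power2_eq_square mult_right_mono)
  have B0: "0 \<le> B" using B[OF x] by linarith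
  show "- B - e * (real N)\<^sup>2 \<le> disc_fun ?v n x"
  proof (cases "x \<le> d")
    \<comment> \<open>Here x - d may leave the unit interval; nonnegativity of the count
      suffices.\<close>
    case True
    then have "real n * x \<le> real n * d" by (simp add: mult_left_mono)
    then show ?thesis using nd B0 by (simp add: disc_fun_def)
  next
    case False
    moreover have "0 \<le> d" using e by (simp add: d_def)
    ultimately have y: "x - d \<in> {0..1}" using x by auto
    have "count_below w n (x - d) \<le> count_below ?v n x"
      unfolding count_below_def
    proof (intro card_mono subsetI CollectI)
      fix k assume "k \<in> {k \<in> {1..n}. w k < x - d}"
      moreover have "e * real k \<le> d" if "k \<le> n"
        using that n e by (simp add: d_def)
      ultimately show "k \<in> {1..n} \<and> ?v k < x" by fastforce
    qed auto
    then have "disc_fun w n (x - d) - real n * d \<le> disc_fun ?v n x"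
      by (simp add: disc_fun_def algebra_simps)
    then show ?thesis using B[OF y] nd by (simp add: abs_le_iff)
  qed
qed

section \<open>Lower bounds for arbitrary sequences\<close>

lemma large_discrepancy:
  assumes w: "w \<in> unit_seqs"
  shows "\<exists>n\<in>{1..4 ^ t}. 23/256 * real t \<le> real n * star_discrepancy w n"
proof -
  define N where "N = (4::nat) ^ t"
  define B where "B = Max ((\<lambda>n. real n * star_discrepancy w n) ` {0..N})"
  have B: "\<bar>disc_fun w n y\<bar> \<le> B" if "n \<le> N" "y \<in> {0..1}" for n y
  proof -
    have "\<bar>disc_fun w n y\<bar> \<le> real n * star_discrepancy w n"
      using abs_disc_fun_le_star that by blast
    also have "\<dots> \<le> B" unfolding B_def using that by (intro Max_ge) auto
    finally show ?thesis .
  qed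
  \<comment> \<open>The oscillation bound for the perturbed sequences passes to the limit e -> 0,
    where it reads 23t/128 <= 2B.\<close>
  have "\<forall>\<^sub>F e in at_right 0. 23/128 * real t \<le> B - (- B - e * (real N)\<^sup>2)"
    using eventually_generic_perturbation[OF w, of N] eventually_at_right_less[of "0::real"]
  proof eventually_elim
    case (elim e)
    show ?case
      by (rule oscillation_ge[OF elim(1)[unfolded N_def]])
         (use disc_fun_perturb[OF elim(2), of _ N _ w B] B in \<open>auto simp: N_def\<close>)
  qed
  moreover have "((\<lambda>e. B - (- B - e * (real N)\<^sup>2)) \<longlongrightarrow> 2 * B) (at_right 0)"
    by (auto intro!: tendsto_eq_intros)
  ultimately have "23/128 * real t \<le> 2 * B"
    by (intro tendsto_lowerbound[of _ "2 * B" "at_right 0"]) auto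
  then have 1: "23/256 * real t \<le> B" by simp
  have "B \<in> (\<lambda>n. real n * star_discrepancy w n) ` {0..N}"
    unfolding B_def by (intro Max_in) auto
  then obtain n where n: "n \<le> N" "B = real n * star_discrepancy w n" by auto
  show ?thesis
  proof (cases "n = 0")
    \<comment> \<open>n = 0 forces B = 0 and hence t = 0, where the index 1 works trivially.\<close>
    case True
    then have "t = 0" using 1 n by simp
    have "0 \<le> \<bar>disc_fun w 1 0\<bar>" by simp
    also have "\<dots> \<le> real 1 * star_discrepancy w 1" by (rule abs_disc_fun_le_star) simp
    finally show ?thesis using \<open>t = 0\<close> by auto
  next
    case False
    then show ?thesis using 1 n by (intro bexI[of _ n]) (auto simp: N_def)
  qed
qed

lemma infinite_large_discrepancy:
  assumes w: "w \<in> unit_seqs"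
  shows "infinite {N::nat. N \<ge> 1 \<and> real N * star_discrepancy w N \<ge> 0.0646363 * ln (real N)}"
proof
  let ?S = "{N::nat. N \<ge> 1 \<and> real N * star_discrepancy w N \<ge> 0.0646363 * ln (real N)}"
  assume "finite ?S"
  define M where "M = Max ?S"
  have M: "n \<le> M" if "n \<in> ?S" for n
    unfolding M_def using \<open>finite ?S\<close> that by (rule Max_ge)
  \<comment> \<open>With t this large, n D_n <= n <= M contradicts the lower bound 23t/256.\<close>
  obtain t :: nat where "real M / (23/256) < real t"
    using reals_Archimedean2 by blast
  then have t: "real M < 23/256 * real t" by simp
  obtain n where n: "n \<in> {1..4 ^ t}" "23/256 * real t \<le> real n * star_discrepancy w n"
    using large_discrepancy[OF w] by blast
  have "real n \<le> real (4 ^ t)"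
    using n(1) by (simp only: of_nat_le_iff atLeastAtMost_iff)
  moreover have "0 < real n"
    using n(1) by simp
  ultimately have "ln (real n) \<le> ln (4 ^ t)"
    by (subst ln_le_cancel_iff) (simp_all only: of_nat_power of_nat_numeral zero_less_power zero_less_numeral)
  also have "\<dots> = real t * ln (2 ^ 2)"
    by (subst ln_realpow) simp_all
  also have "\<dots> = real t * (2 * ln 2)"
    by (subst ln_realpow) simp_all
  finally have "0.0646363 * ln (real n) \<le> real t * (0.1292726 * ln 2)" by simp
  \<comment> \<open>0.1292726 * 25/36 < 0.08978 < 23/256.\<close>
  also have "\<dots> \<le> real t * (23/256)"
    using ln2_le_25_over_36 by (intro mult_left_mono) auto
  finally have "n \<in> ?S" using n by auto
  then have "real n \<le> real M" using M by simp
  moreover have "real n * star_discrepancy w n \<le> real n"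
    using star_discrepancy_le_1[of w n] by (simp add: mult_left_le)
  ultimately show False using n(2) t by linarith
qed

theorem theorem1:
  shows "c_star \<ge> ereal 0.0646363 \<and>
    (\<forall>w\<in>unit_seqs. infinite {N::nat. N \<ge> 1 \<and>
       real N * star_discrepancy w N \<ge> 0.0646363 * ln (real N)})"
proof (intro conjI ballI infinite_large_discrepancy)
  show "c_star \<ge> ereal 0.0646363"
    unfolding c_star_def
  proof (rule INF_greatest)
    fix w assume w: "w \<in> unit_seqs"
    let ?S = "{N::nat. N \<ge> 1 \<and> real N * star_discrepancy w N \<ge> 0.0646363 * ln (real N)}"
    have "\<exists>N\<ge>n. ereal 0.0646363 \<le> ereal (real N * star_discrepancy w N / ln (real N))" for n
    proof -
      \<comment> \<open>N > 1 makes ln N positive, so dividing by it is legitimate.\<close>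
      have "\<exists>N>max n 1. N \<in> ?S"
        by (rule infinite_large_discrepancy[OF w, unfolded infinite_nat_iff_unbounded, THEN spec])
      then obtain N where N: "N \<in> ?S" "N > max n 1" by blast
      then have "0 < ln (real N)" by simp
      then show ?thesis using N by (intro exI[of _ N]) (auto simp: field_simps)
    qed
    then have "ereal 0.0646363 \<le> (SUP N\<in>{n..}. ereal (real N * star_discrepancy w N / ln (real N)))" for n
      by (meson SUP_upper2 atLeast_iff)
    then show "ereal 0.0646363 \<le> limsup (\<lambda>N. ereal (real N * star_discrepancy w N / ln (real N)))"
      unfolding limsup_INF_SUP by (rule INF_greatest)
  qed
qed

end
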